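(* Let $X$ be an SDL topological space. Then $wL_c(X) \leq t(X)$.
   Context: A space is Lindelöf if every open cover has a countable subcover (no separation axiom is included). A subset $D$ of a topological space $X$ is strongly discrete if for every $x \in D$ there is an open neighbourhood $U_x \subset X$ of $x$ such that $\{U_x : x \in D\}$ is a pairwise disjoint family (indexed by $D$, i.e. $U_x\cap U_y=\emptyset$ for distinct $x,y\in D$). A space $X$ is SDL if the closure in $X$ of every strongly discrete subset of $X$ is Lindelöf. Cardinal functions take infinite values, as is usual. $wL_c(X)$ is the minimum (infinite) cardinal $\kappa$ such that, for every closed set $F \subset X$ and every family $\mathcal{U}$ of open subsets of $X$ covering $F$, there is a subcollection $\mathcal{V} \subset \mathcal{U}$ with $|\mathcal{V}| \leq \kappa$ and $F \subset \overline{\bigcup \mathcal{V}}$. $t(X)$ is the tightness of $X$: the least infinite cardinal $\kappa$ such that whenever $A \subset X$ and $x \in \overline{A}$ there is $B \subset A$ with $|B| \leq \kappa$ and $x \in \overline{B}$. *)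

theory Defs
  imports "HOL-Analysis.Analysis"
begin

unbundle cardinal_syntax

definition strongly_discrete_in :: "'a topology \<Rightarrow> 'a set \<Rightarrow> bool" where
  "strongly_discrete_in X D \<longleftrightarrow>
     D \<subseteq> topspace X \<and>
     (\<exists>U. (\<forall>x\<in>D. openin X (U x) \<and> x \<in> U x) \<and> disjoint_family_on U D)"

definition SDL_space :: "'a topology \<Rightarrow> bool" where
  "SDL_space X \<longleftrightarrow>
     (\<forall>D. strongly_discrete_in X D \<longrightarrow> Lindelof_space (subtopology X (X closure_of D)))"

text \<open>
  Cardinals are represented by cardinal orders, compared by \<open>\<le>o\<close>. The predicates below make
  sense for cardinal orders over an arbitrary type; the minima are taken over the cardinal
  orders on subsets of \<open>'a set + nat\<close>. This type is infinite and large enough for both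
  minima to be attained in it, and a cardinal order over any other type that satisfies the
  predicate is not smaller: see \<open>wLc_spec\<close>, \<open>wLc_least\<close>, \<open>tightness_spec\<close> and \<open>tightness_least\<close>.
\<close>

definition least_infinite_card :: "('b rel \<Rightarrow> bool) \<Rightarrow> 'b rel" where
  "least_infinite_card P = (SOME \<kappa>.
     (Card_order \<kappa> \<and> infinite (Field \<kappa>) \<and> P \<kappa>) \<and>
     (\<forall>\<mu>. Card_order \<mu> \<and> infinite (Field \<mu>) \<and> P \<mu> \<longrightarrow> \<kappa> \<le>o \<mu>))"

definition wLc_bounded_by :: "'a topology \<Rightarrow> 'b rel \<Rightarrow> bool" where
  "wLc_bounded_by X \<kappa> \<longleftrightarrow>
     (\<forall>F \<U>. closedin X F \<and> (\<forall>U\<in>\<U>. openin X U) \<and> F \<subseteq> \<Union>\<U> \<longrightarrow>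
        (\<exists>\<V>\<subseteq>\<U>. |\<V>| \<le>o \<kappa> \<and> F \<subseteq> X closure_of (\<Union>\<V>)))"

definition wLc :: "'a topology \<Rightarrow> ('a set + nat) rel" where
  "wLc X = least_infinite_card (wLc_bounded_by X)"

definition tightness_bounded_by :: "'a topology \<Rightarrow> 'b rel \<Rightarrow> bool" where
  "tightness_bounded_by X \<kappa> \<longleftrightarrow>
     (\<forall>A x. A \<subseteq> topspace X \<and> x \<in> X closure_of A \<longrightarrow>
        (\<exists>B\<subseteq>A. |B| \<le>o \<kappa> \<and> x \<in> X closure_of B))"

definition tightness :: "'a topology \<Rightarrow> ('a set + nat) rel" where
  "tightness X = least_infinite_card (tightness_bounded_by X)"

lemma least_infinite_card_spec:
  assumes "Card_order \<mu>" "infinite (Field \<mu>)" "P \<mu>"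
  shows "Card_order (least_infinite_card P)" "infinite (Field (least_infinite_card P))"
    "P (least_infinite_card P)"
    "\<And>\<mu>. Card_order \<mu> \<Longrightarrow> infinite (Field \<mu>) \<Longrightarrow> P \<mu> \<Longrightarrow> least_infinite_card P \<le>o \<mu>"
proof -
  let ?R = "{\<kappa>. Card_order \<kappa> \<and> infinite (Field \<kappa>) \<and> P \<kappa>}"
  have "\<exists>\<kappa>\<in>?R. \<forall>\<mu>\<in>?R. \<kappa> \<le>o \<mu>"
    by (rule exists_minim_Card_order) (use assms in auto)
  then have "\<exists>\<kappa>. (Card_order \<kappa> \<and> infinite (Field \<kappa>) \<and> P \<kappa>) \<and>
     (\<forall>\<mu>. Card_order \<mu> \<and> infinite (Field \<mu>) \<and> P \<mu> \<longrightarrow> \<kappa> \<le>o \<mu>)"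
    by auto
  from someI_ex[OF this, folded least_infinite_card_def]
  show "Card_order (least_infinite_card P)" "infinite (Field (least_infinite_card P))"
    "P (least_infinite_card P)"
    "\<And>\<mu>. Card_order \<mu> \<Longrightarrow> infinite (Field \<mu>) \<Longrightarrow> P \<mu> \<Longrightarrow> least_infinite_card P \<le>o \<mu>"
    by blast+
qed

lemma least_infinite_card_le:
  fixes P :: "'b rel \<Rightarrow> bool" and \<mu> :: "'c rel"
  assumes UNIV: "infinite (UNIV :: 'b set)" "P |UNIV :: 'b set|"
    and \<mu>: "Card_order \<mu>" "infinite (Field \<mu>)"
    and transfer: "\<And>\<kappa> :: 'b rel. \<mu> \<le>o \<kappa> \<Longrightarrow> P \<kappa>"
  shows "least_infinite_card P \<le>o \<mu>"
proof -
  have U: "Card_order |UNIV :: 'b set|" "infinite (Field |UNIV :: 'b set| )"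
    using UNIV by (simp_all add: Field_card_of card_of_card_order_on)
  note spec = least_infinite_card_spec[of _ P, OF U UNIV(2)]
  show ?thesis
  proof (cases "|Field \<mu>| \<le>o |UNIV :: 'b set|")
    case True
    then obtain B :: "'b set" where B: "|Field \<mu>| =o |B|"
      using internalize_card_of_ordLeq[of "Field \<mu>" "|UNIV :: 'b set|"]
      by (auto simp: Field_card_of)
    have iso: "\<mu> =o |B|"
      by (rule ordIso_transitive[OF ordIso_symmetric[OF card_of_Field_ordIso[OF \<mu>(1)]] B])
    have "infinite B"
      using B \<mu>(2) card_of_ordIso_finite by blast
    then have "least_infinite_card P \<le>o |B|"
      using ordIso_imp_ordLeq[OF iso]
      by (intro spec(4) transfer) (simp_all only: Field_card_of card_of_card_order_on not_False_eq_True)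
    then show ?thesis
      by (rule ordLeq_ordIso_trans[OF _ ordIso_symmetric[OF iso]])
  next
    case False
    then have ge: "|UNIV :: 'b set| \<le>o |Field \<mu>|"
      using ordLeq_total[OF card_of_Well_order card_of_Well_order] by blast
    have "least_infinite_card P \<le>o |UNIV :: 'b set|"
      by (rule spec(4)[OF U UNIV(2)])
    from ordLeq_transitive[OF this ge] show ?thesis
      by (rule ordLeq_ordIso_trans[OF _ card_of_Field_ordIso[OF \<mu>(1)]])
  qed
qed

lemma wLc_bounded_by_mono:
  assumes "wLc_bounded_by X \<mu>" "\<mu> \<le>o \<kappa>"
  shows "wLc_bounded_by X \<kappa>"
  unfolding wLc_bounded_by_def
proof (intro allI impI)
  fix F \<U> assume "closedin X F \<and> (\<forall>U\<in>\<U>. openin X U) \<and> F \<subseteq> \<Union>\<U>"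
  with assms(1) obtain \<V> where V: "\<V> \<subseteq> \<U>" "|\<V>| \<le>o \<mu>" "F \<subseteq> X closure_of (\<Union>\<V>)"
    unfolding wLc_bounded_by_def by meson
  show "\<exists>\<V>\<subseteq>\<U>. |\<V>| \<le>o \<kappa> \<and> F \<subseteq> X closure_of (\<Union>\<V>)"
    by (intro exI[of _ \<V>] conjI V ordLeq_transitive[OF V(2) assms(2)])
qed

lemma tightness_bounded_by_mono:
  assumes "tightness_bounded_by X \<mu>" "\<mu> \<le>o \<kappa>"
  shows "tightness_bounded_by X \<kappa>"
  unfolding tightness_bounded_by_def
proof (intro allI impI)
  fix A x assume "A \<subseteq> topspace X \<and> x \<in> X closure_of A"
  with assms(1) obtain B where B: "B \<subseteq> A" "|B| \<le>o \<mu>" "x \<in> X closure_of B"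
    unfolding tightness_bounded_by_def by meson
  show "\<exists>B\<subseteq>A. |B| \<le>o \<kappa> \<and> x \<in> X closure_of B"
    by (intro exI[of _ B] conjI B ordLeq_transitive[OF B(2) assms(2)])
qed

lemma wLc_bounded_by_UNIV:
  fixes X :: "'a topology"
  shows "wLc_bounded_by X |UNIV :: ('a set + nat) set|"
  unfolding wLc_bounded_by_def
proof (intro allI impI, elim conjE)
  fix F \<U> assume *: "closedin X F" "\<forall>U\<in>\<U>. openin X U" "F \<subseteq> \<Union>\<U>"
  have "|\<U>| \<le>o |UNIV :: ('a set + nat) set|"
    by (rule card_of_ordLeqI[of Inl]) simp_all
  moreover have "\<Union>\<U> \<subseteq> X closure_of (\<Union>\<U>)"
    using *(2) by (intro closure_of_subset Union_least openin_subset) simp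
  ultimately show "\<exists>\<V>\<subseteq>\<U>. |\<V>| \<le>o |UNIV :: ('a set + nat) set| \<and> F \<subseteq> X closure_of (\<Union>\<V>)"
    using *(3) by (intro exI[of _ \<U>] conjI subset_refl) (assumption | rule subset_trans)+
qed

lemma tightness_bounded_by_UNIV:
  fixes X :: "'a topology"
  shows "tightness_bounded_by X |UNIV :: ('a set + nat) set|"
  unfolding tightness_bounded_by_def
proof (intro allI impI, elim conjE)
  fix A x assume "x \<in> X closure_of A"
  moreover have "|A| \<le>o |UNIV :: ('a set + nat) set|"
    by (rule card_of_ordLeqI[of "\<lambda>x. Inl {x}"]) (simp_all add: inj_on_def)
  ultimately show "\<exists>B\<subseteq>A. |B| \<le>o |UNIV :: ('a set + nat) set| \<and> x \<in> X closure_of B"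
    by (intro exI[of _ A] conjI subset_refl)
qed

lemma infinite_UNIV_set_plus_nat: "infinite (UNIV :: ('a set + nat) set)"
  by simp

lemma
  fixes X :: "'a topology"
  shows wLc_spec: "Card_order (wLc X)" "infinite (Field (wLc X))" "wLc_bounded_by X (wLc X)"
    and tightness_spec: "Card_order (tightness X)" "infinite (Field (tightness X))"
      "tightness_bounded_by X (tightness X)"
proof -
  have U: "Card_order |UNIV :: ('a set + nat) set|" "infinite (Field |UNIV :: ('a set + nat) set| )"
    by (simp_all only: Field_card_of card_of_card_order_on infinite_UNIV_set_plus_nat not_False_eq_True)
  show "Card_order (wLc X)" "infinite (Field (wLc X))" "wLc_bounded_by X (wLc X)"
    unfolding wLc_def
    by (rule least_infinite_card_spec(1-3)[where P = "wLc_bounded_by X", OF U wLc_bounded_by_UNIV])+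
  show "Card_order (tightness X)" "infinite (Field (tightness X))"
    "tightness_bounded_by X (tightness X)"
    unfolding tightness_def
    by (rule least_infinite_card_spec(1-3)[where P = "tightness_bounded_by X",
          OF U tightness_bounded_by_UNIV])+
qed

lemma wLc_least:
  "Card_order \<mu> \<Longrightarrow> infinite (Field \<mu>) \<Longrightarrow> wLc_bounded_by X \<mu> \<Longrightarrow> wLc X \<le>o \<mu>"
  unfolding wLc_def
  by (rule least_infinite_card_le[where P = "wLc_bounded_by X",
        OF infinite_UNIV_set_plus_nat wLc_bounded_by_UNIV])
    (simp_all add: wLc_bounded_by_mono)

lemma tightness_least:
  "Card_order \<mu> \<Longrightarrow> infinite (Field \<mu>) \<Longrightarrow> tightness_bounded_by X \<mu> \<Longrightarrow> tightness X \<le>o \<mu>"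
  unfolding tightness_def
  by (rule least_infinite_card_le[where P = "tightness_bounded_by X",
        OF infinite_UNIV_set_plus_nat tightness_bounded_by_UNIV])
    (simp_all add: tightness_bounded_by_mono)

end

(* If no subfamily of size \<kappa> = t(X) has a union dense in F, one can choose points x_\<alpha> of F,
   \<alpha> < \<kappa>\<^sup>+, such that x_\<alpha> lies outside the closure of the union of \<V>_\<alpha>. Here \<V>_\<alpha> contains, for each
   \<beta> < \<alpha>, a member G_\<beta> around x_\<beta> and countably many members that cover the closure of
   {x_\<gamma>. \<gamma> \<le> \<beta>} if this set is strongly discrete. Removing the closure of \<Union>\<V>_\<alpha> from G_\<alpha> gives
   disjoint neighbourhoods, so the set D of all x_\<alpha> is strongly discrete and its closure is
   Lindeloef. Tightness \<kappa> and regularity of \<kappa>\<^sup>+ show that the increasing open sets \<Union>\<V>_\<alpha> cover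
   this closure, so by regularity again one of them does, but \<Union>\<V>_\<alpha> misses x_\<alpha>. *)
theory Submission
  imports Defs
begin

lemma strongly_discrete_in_subset:
  assumes "strongly_discrete_in X D" "E \<subseteq> D"
  shows "strongly_discrete_in X E"
  using assms disjoint_family_on_mono[OF assms(2)] unfolding strongly_discrete_in_def by blast

text \<open>Disjointness of the neighbourhoods \<open>W i\<close> forces \<open>f\<close> to be
  injective, so they can be reindexed by the points \<open>f i\<close> via the inverse of
  \<open>f\<close>.\<close>

lemma strongly_discrete_in_image:
  assumes "\<And>i. i \<in> I \<Longrightarrow> openin X (W i) \<and> f i \<in> W i"
    and "disjoint_family_on W I"
  shows "strongly_discrete_in X (f ` I)"
proof -
  have inj: "inj_on f I"
    using assms by (fastforce simp: inj_on_def disjoint_family_on_def)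
  have "disjoint_family_on (W \<circ> the_inv_into I f) (f ` I)"
    using assms(2) the_inv_into_f_f[OF inj] by (fastforce simp: disjoint_family_on_def)
  moreover have "f ` I \<subseteq> topspace X"
    using assms(1) openin_subset by blast
  ultimately show ?thesis
    unfolding strongly_discrete_in_def
    using assms(1) by (intro conjI exI[of _ "W \<circ> the_inv_into I f"])
      (auto simp: the_inv_into_f_f[OF inj])
qed

lemma SDL_space_imp_wLc_bounded_by:
  fixes X :: "'a topology" and \<kappa> :: "'b rel"
  assumes SDL: "SDL_space X" and \<kappa>: "Card_order \<kappa>" "infinite (Field \<kappa>)"
    and tight: "tightness_bounded_by X \<kappa>"
  shows "wLc_bounded_by X \<kappa>"
proof (rule ccontr)
  assume "\<not> wLc_bounded_by X \<kappa>"
  then obtain F \<U> where F: "closedin X F" and *: "\<forall>U\<in>\<U>. openin X U" "F \<subseteq> \<Union>\<U>"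
      "\<nexists>\<V>. \<V> \<subseteq> \<U> \<and> |\<V>| \<le>o \<kappa> \<and> F \<subseteq> X closure_of (\<Union>\<V>)"
    unfolding wLc_bounded_by_def not_all not_imp by (elim exE conjE)
  have \<U>: "\<And>U. U \<in> \<U> \<Longrightarrow> openin X U" "F \<subseteq> \<Union>\<U>"
    and neg: "\<And>\<V>. \<V> \<subseteq> \<U> \<Longrightarrow> |\<V>| \<le>o \<kappa> \<Longrightarrow> \<not> F \<subseteq> X closure_of (\<Union>\<V>)"
    using * by simp_all
  have FX: "F \<subseteq> topspace X"
    using F closedin_subset by blast
  have "\<forall>x\<in>F. \<exists>U. U \<in> \<U> \<and> x \<in> U"
    using \<U>(2) by blast
  then obtain G where G: "\<And>x. x \<in> F \<Longrightarrow> G x \<in> \<U> \<and> x \<in> G x"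
    unfolding bchoice_iff by blast
  \<comment> \<open>The choice is made for every set \<open>S\<close>, with the covering property
    only conditional: during the recursion it is not yet known that the initial segments are
    strongly discrete.\<close>
  have "\<forall>S. \<exists>\<V>. countable \<V> \<and> \<V> \<subseteq> \<U> \<and>
      (S \<subseteq> F \<and> strongly_discrete_in X S \<longrightarrow> X closure_of S \<subseteq> \<Union>\<V>)"
  proof
    fix S
    show "\<exists>\<V>. countable \<V> \<and> \<V> \<subseteq> \<U> \<and>
      (S \<subseteq> F \<and> strongly_discrete_in X S \<longrightarrow> X closure_of S \<subseteq> \<Union>\<V>)"
    proof (cases "S \<subseteq> F \<and> strongly_discrete_in X S")
      case True
      then have "X closure_of S \<subseteq> \<Union>\<U>"
        using closure_of_minimal[OF _ F] \<U>(2) by blast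
      moreover have "Lindelof_space (subtopology X (X closure_of S))"
        using True SDL by (simp add: SDL_space_def)
      ultimately have "\<exists>\<V>. countable \<V> \<and> \<V> \<subseteq> \<U> \<and> X closure_of S \<subseteq> \<Union>\<V>"
        using \<U>(1) by (simp add: Lindelof_space_subtopology_subset closure_of_subset_topspace)
      then show ?thesis
        by blast
    next
      case False
      then show ?thesis
        by (intro exI[of _ "{}"]) auto
    qed
  qed
  from choice[OF this] obtain C where "\<forall>S. countable (C S) \<and> C S \<subseteq> \<U> \<and>
      (S \<subseteq> F \<and> strongly_discrete_in X S \<longrightarrow> X closure_of S \<subseteq> \<Union>(C S))" ..
  then have C: "\<And>S. countable (C S)" "\<And>S. C S \<subseteq> \<U>"
    "\<And>S. S \<subseteq> F \<Longrightarrow> strongly_discrete_in X S \<Longrightarrow> X closure_of S \<subseteq> \<Union>(C S)"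
    by simp_all

  let ?r = "cardSuc \<kappa>"
  have r: "Card_order ?r" "infinite (Field ?r)"
    using \<kappa> by (simp_all add: cardSuc_Card_order cardSuc_finite)
  have "wo_rel ?r"
    using r(1) by (simp add: wo_rel_def card_order_on_def)
  note r_order = wo_rel.TRANS[OF this] wo_rel.ANTISYM[OF this] wo_rel.TOTALS[OF this]
    and WF = wo_rel.WF[OF this] and REFL = wo_rel.REFL[OF this]
  have under_underS: "k \<in> underS ?r i" if k: "k \<in> under ?r j" and j: "j \<in> underS ?r i" for i j k
  proof -
    have "(k, j) \<in> ?r" "(j, i) \<in> ?r" "j \<noteq> i"
      using k j by (simp_all add: under_def underS_def)
    then have "(k, i) \<in> ?r" "k \<noteq> i"
      using transD[OF r_order(1)] antisymD[OF r_order(2)] by blast+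
    then show ?thesis
      by (simp add: underS_def)
  qed
  have small: "|underS ?r i| \<le>o \<kappa>" for i
  proof (cases "i \<in> Field ?r")
    case True
    then show ?thesis
      by (rule iffD1[OF cardSuc_ordLeq_ordLess[OF \<kappa>(1) card_of_Card_order] card_of_underS[OF r(1)]])
  next
    \<comment> \<open>The recursion below runs over the whole type \<open>'b set\<close>, so indices
      outside the field also need the bound.\<close>
    case False
    then have "underS ?r i = {}"
      by (auto simp: underS_def Field_def)
    then show ?thesis
      using Card_order_empty[OF \<kappa>(1)] by simp
  qed
  have countable_small: "|A| \<le>o \<kappa>" if "countable A" for A :: "'c set"
  proof -
    have "|A| \<le>o |UNIV :: nat set|"
      using that unfolding countable_def by (metis card_of_ordLeq subset_UNIV)
    also have "|UNIV :: nat set| \<le>o |Field \<kappa>|"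
      using \<kappa>(2) by (rule iffD1[OF infinite_iff_card_of_nat])
    also have "|Field \<kappa>| =o \<kappa>"
      using \<kappa>(1) by (rule card_of_Field_ordIso)
    finally show ?thesis .
  qed

  \<comment> \<open>The outer index is strict, so \<open>V f i\<close> depends only on the values of
    \<open>f\<close> before \<open>i\<close>, as the recursion requires. The inner segment may
    include \<open>j\<close> itself, since \<open>j\<close> is already below
    \<open>i\<close>.\<close>
  define V where "V f i = (\<Union>j\<in>underS ?r i. insert (G (f j)) (C (f ` under ?r j)))" for f i
  have "\<exists>f. \<forall>i. f i \<in> F - X closure_of (\<Union>(V f i))"
  proof (rule dependent_wf_choice)
    show "wf (?r - Id)"
      by (rule WF)
  next
    fix f g :: "'b set \<Rightarrow> 'a" and i x
    assume eq: "\<And>j. (j, i) \<in> ?r - Id \<Longrightarrow> f j = g j"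
    have eqS: "f j = g j" if "j \<in> underS ?r i" for j
      using that by (intro eq) (simp add: underS_def)
    have "f ` under ?r j = g ` under ?r j" if "j \<in> underS ?r i" for j
      using eqS under_underS that by (intro image_cong refl) blast
    then have "V f i = V g i"
      unfolding V_def using eqS by (intro SUP_cong refl) simp
    then show "(x \<in> F - X closure_of (\<Union>(V f i))) = (x \<in> F - X closure_of (\<Union>(V g i)))"
      by simp
  next
    fix i and f :: "'b set \<Rightarrow> 'a"
    assume IH: "\<And>j. (j, i) \<in> ?r - Id \<Longrightarrow> f j \<in> F - X closure_of (\<Union>(V f j))"
    have "f j \<in> F" if "j \<in> underS ?r i" for j
      using that IH by (auto simp: underS_def)
    then have "V f i \<subseteq> \<U>"
      using C(2) G by (fastforce simp: V_def)
    \<comment> \<open>A union of at most \<kappa> countable families, with \<kappa>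
      infinite.\<close>
    moreover have "|V f i| \<le>o \<kappa>"
      unfolding V_def using C(1) 
      by (intro card_of_UNION_ordLeq_infinite_Field[OF \<kappa>(2,1) small] ballI countable_small) simp
    ultimately show "\<exists>x. x \<in> F - X closure_of (\<Union>(V f i))"
      using neg by blast
  qed
  then obtain f where fF: "\<And>i. f i \<in> F" and f: "\<And>i. f i \<notin> X closure_of (\<Union>(V f i))"
    by blast
  have V\<U>: "V f i \<subseteq> \<U>" for i
    using C(2) G fF by (fastforce simp: V_def)
  have V_closure: "\<Union>(V f i) \<subseteq> X closure_of (\<Union>(V f i))" for i
    using V\<U> \<U>(1) by (intro closure_of_subset Union_least openin_subset) blast

  define D where "D = f ` Field ?r"
  define W where "W i = G (f i) - X closure_of (\<Union>(V f i))" for i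
  \<comment> \<open>\<open>G (f i)\<close> is a member of \<open>V f j\<close>, so all of
    \<open>W i\<close> lies in the set removed from \<open>G (f j)\<close>.\<close>
  have disj: "W i \<inter> W j = {}" if "i \<in> underS ?r j" for i j
    using that V_closure[of j] by (auto simp: W_def V_def)
  have D: "strongly_discrete_in X D"
    unfolding D_def
  proof (rule strongly_discrete_in_image)
    show "openin X (W i) \<and> f i \<in> W i" if "i \<in> Field ?r" for i
      using G[OF fF] f \<U>(1) by (auto simp: W_def intro: openin_diff)
    show "disjoint_family_on W (Field ?r)"
      unfolding disjoint_family_on_def
    proof (intro ballI impI)
      fix i j assume "i \<in> Field ?r" "j \<in> Field ?r" "i \<noteq> j"
      then have "i \<in> underS ?r j \<or> j \<in> underS ?r i"
        using r_order(3) by (auto simp: underS_def)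
      then show "W i \<inter> W j = {}"
        using disj by blast
    qed
  qed
  have under_Field: "under ?r i \<subseteq> Field ?r" for i
    by (auto simp: under_def Field_def)
  have self: "i \<in> under ?r i" if "i \<in> Field ?r" for i
    using that REFL by (auto simp: under_def refl_on_def)
  \<comment> \<open>This is regularity of the successor cardinal. It serves twice: with
    \<open>h = f\<close> for sets given by tightness, and with \<open>h = id\<close> for countable
    sets of indices.\<close>
  have bounded: "\<exists>i\<in>Field ?r. B \<subseteq> h ` under ?r i"
    if "B \<subseteq> h ` Field ?r" "|B| \<le>o \<kappa>" for B :: "'c set" and h
  proof (rule cardSuc_UNION[OF \<kappa> _ _ that(2)])
    show "relChain ?r (\<lambda>i. h ` under ?r i)"
      unfolding relChain_def using under_incr[OF r_order(1)] by (intro allI impI image_mono)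
    show "B \<subseteq> (\<Union>i\<in>Field ?r. h ` under ?r i)"
      using that(1) self by blast
  qed
  define O' where "O' i = \<Union>(C (f ` under ?r i))" for i
  have cover: "X closure_of D \<subseteq> (\<Union>i\<in>Field ?r. O' i)"
  proof
    fix y assume "y \<in> X closure_of D"
    moreover have "D \<subseteq> topspace X"
      using fF FX by (auto simp: D_def)
    ultimately obtain B where B: "B \<subseteq> D" "|B| \<le>o \<kappa>" "y \<in> X closure_of B"
      using tight unfolding tightness_bounded_by_def by blast
    then obtain i where i: "i \<in> Field ?r" "B \<subseteq> f ` under ?r i"
      using bounded unfolding D_def by blast
    \<comment> \<open>As part of \<open>D\<close>, the segment meets the condition under which
      \<open>C\<close> covers its closure.\<close>
    have "strongly_discrete_in X (f ` under ?r i)"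
      unfolding D_def using under_Field
      by (intro strongly_discrete_in_subset[OF D[unfolded D_def]] image_mono)
    then have "X closure_of (f ` under ?r i) \<subseteq> O' i"
      unfolding O'_def using fF by (intro C(3)) auto
    then show "y \<in> (\<Union>i\<in>Field ?r. O' i)"
      using closure_of_mono[OF i(2)] B(3) i(1) by (meson UN_I subsetD)
  qed
  have "Lindelof_space (subtopology X (X closure_of D))"
    using SDL D by (simp add: SDL_space_def)
  moreover have "openin X (O' i)" for i
    unfolding O'_def using C(2) \<U>(1) by blast
  ultimately have "\<exists>\<W>. countable \<W> \<and> \<W> \<subseteq> O' ` Field ?r \<and> X closure_of D \<subseteq> \<Union>\<W>"
    using cover by (simp add: Lindelof_space_subtopology_subset closure_of_subset_topspace)
  then obtain N where N: "countable N" "N \<subseteq> Field ?r" "X closure_of D \<subseteq> (\<Union>i\<in>N. O' i)"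
    unfolding ex_countable_subset_image by blast
  obtain i where i: "i \<in> Field ?r" "N \<subseteq> under ?r i"
    using bounded[of N id] N(2) countable_small[OF N(1)] by (auto simp only: image_id id_apply)
  \<comment> \<open>An index strictly above \<open>i\<close> is needed because \<open>V f k\<close>
    collects only strictly earlier stages; an infinite cardinal has no last element.\<close>
  obtain k where k: "k \<in> Field ?r" "i \<in> underS ?r k"
    using infinite_Card_order_limit[OF r(1,2) i(1)] by (auto simp: underS_def)
  have "f k \<in> X closure_of D"
    using k(1) fF FX closure_of_subset[of D X] by (auto simp: D_def)
  then obtain j where j: "j \<in> N" "f k \<in> O' j"
    using N(3) by blast
  \<comment> \<open>Hence the family whose union is \<open>O' j\<close> is contained in
    \<open>V f k\<close>, whose union \<open>f k\<close> was chosen to avoid.\<close>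
  have "j \<in> underS ?r k"
    using j(1) i(2) k(2) under_underS by blast
  then have "f k \<in> \<Union>(V f k)"
    using j(2) by (auto simp: V_def O'_def)
  then show False
    using V_closure f by blast
qed

theorem lemma5:
  fixes X :: "'a topology"
  assumes "SDL_space X"
  shows "wLc X \<le>o tightness X"
  by (rule wLc_least[OF tightness_spec(1,2) SDL_space_imp_wLc_bounded_by[OF assms tightness_spec]])

end
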